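(* Suppose $0<\eta\le\frac{2\varepsilon}{M_x^2}$, and let $(f^t,g^t,h^t)$ and $(\tilde f^{t+1},\tilde g^{t+1},\tilde h^{t+1})$, $t\in\mathbb{N}_0$, be generated by the modified Sinkhorn algorithm with step size $\eta$ started from $(f^0,g^0,h^0)\in\mathcal{C}_\diamond(\mathcal{U})\times\mathcal{C}_\diamond(\mathcal{U};\mathbb{R}^{d_x})\times\mathcal{C}(\mathcal{X}\times\mathcal{Y})$. Then for every $t\in\mathbb{N}_0$, $$D(f^t,g^t,h^t)\le D(f^t,g^t,\tilde h^{t+1})\le D(\tilde f^{t+1},g^t,\tilde h^{t+1})\le D(\tilde f^{t+1},\tilde g^{t+1},\tilde h^{t+1})=D(f^{t+1},g^{t+1},h^{t+1}).$$
   Context: Setting. Let $(X,Y)$ be a random vector in $\mathbb{R}^{d_x}\times\mathbb{R}^{d_y}$ with law $\nu$; let $\mathcal{X}$, $\mathcal{Y}$ be the supports of $X$, $Y$. Let $\mu$ be a Borel probability measure on $\mathbb{R}^{d_y}$ with support $\mathcal{U}$. Assume $\mathcal{U},\mathcal{X},\mathcal{Y}$ are compact, $\mathbb{E}[X]=0$ and $\Sigma_X:=\mathbb{E}[XX^\top]$ is invertible. Fix $\varepsilon>0$; $c(u,y):=\|u-y\|^2/2$; $M_x:=\sup_{x\in\mathcal{X}}\|x\|$. The dual objective is $$D(f,g,h):=\int f\,d\mu+\int h\,d\nu-\varepsilon\left(\int e^{(f(u)+\langle g(u),x\rangle+h(x,y)-c(u,y))/\varepsilon}\,d(\mu\otimes\nu)(u,x,y)-1\right).$$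 $\mathcal{C}_\diamond(\mathcal{U})$ (resp. $\mathcal{C}_\diamond(\mathcal{U};\mathbb{R}^{d_x})$) is the set of continuous $f:\mathcal{U}\to\mathbb{R}$ (resp. $g:\mathcal{U}\to\mathbb{R}^{d_x}$) with $\int f\,d\mu=0$ (resp. $\int g\,d\mu=0$). Modified Sinkhorn algorithm with step size $\eta>0$. Given $(f^t,g^t,h^t)$: (1) $\tilde h^{t+1}(x,y)=-\varepsilon\log\int e^{(f^t(u)+\langle g^t(u),x\rangle-c(u,y))/\varepsilon}d\mu(u)$ and then $\tilde f^{t+1}(u)=-\varepsilon\log\int e^{(\langle g^t(u),x\rangle+\tilde h^{t+1}(x,y)-c(u,y))/\varepsilon}d\nu(x,y)$; (2) $\tilde g^{t+1}=g^t-\eta\,d_g^t$ with $d_g^t(u)=e^{\tilde f^{t+1}(u)/\varepsilon}\int x\,e^{(\langle g^t(u),x\rangle+\tilde h^{t+1}(x,y)-c(u,y))/\varepsilon}d\nu(x,y)$; (3) $f^{t+1}=\tilde f^{t+1}-\int\tilde f^{t+1}d\mu$, $g^{t+1}=\tilde g^{t+1}-\int\tilde g^{t+1}d\mu$, $h^{t+1}(x,y)=\tilde h^{t+1}(x,y)+\int\tilde f^{t+1}d\mu+\langle\int\tilde g^{t+1}d\mu,x\rangle$. *)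

theory Defs
  imports "HOL-Probability.Probability"
begin

definition msupport :: "'a::topological_space measure \<Rightarrow> 'a set" where
  "msupport M = {x. \<forall>V. open V \<and> x \<in> V \<longrightarrow> emeasure M V > 0}"

text \<open>
  The law \<open>\<nu>\<close> lives on \<open>\<real>\<^sup>d\<^sup>x \<times> \<real>\<^sup>d\<^sup>y\<close>, and the random vector \<open>(X, Y)\<close> is realised by the two
  coordinate projections, so that the supports of \<open>X\<close> and \<open>Y\<close> are those of the two marginals.
\<close>

definition X_supp :: "('a::topological_space \<times> 'b::topological_space) measure \<Rightarrow> 'a set" where
  "X_supp \<nu> = msupport (distr \<nu> borel fst)"

definition Y_supp :: "('a::topological_space \<times> 'b::topological_space) measure \<Rightarrow> 'b set" where
  "Y_supp \<nu> = msupport (distr \<nu> borel snd)"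

definition Sigma_X :: "((real^'m) \<times> (real^'n)) measure \<Rightarrow> real^'m^'m" where
  "Sigma_X \<nu> = (LINT (x, y)|\<nu>. (columnvector x :: real^1^'m) ** rowvector x)"

definition M_x :: "((real^'m) \<times> (real^'n)) measure \<Rightarrow> real" where
  "M_x \<nu> = (SUP x\<in>X_supp \<nu>. norm x)"

definition cost :: "real^'n \<Rightarrow> real^'n \<Rightarrow> real" where
  "cost u y = (norm (u - y))\<^sup>2 / 2"

text \<open>
  Potentials are functions on the supports only, represented by total functions whose values
  elsewhere are irrelevant (and possibly non-measurable).  All integrals are therefore set
  integrals over the supports, whose complements are null sets.
\<close>

definition C_diamond ::
    "'a::topological_space measure \<Rightarrow> ('a \<Rightarrow> 'b::{banach, second_countable_topology}) set" where
  "C_diamond \<mu> = {f. continuous_on (msupport \<mu>) f \<and> (LINT u:msupport \<mu>|\<mu>. f u) = 0}"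

definition dual_obj ::
    "(real^'n) measure \<Rightarrow> ((real^'m) \<times> (real^'n)) measure \<Rightarrow> real \<Rightarrow>
     (real^'n \<Rightarrow> real) \<Rightarrow> (real^'n \<Rightarrow> real^'m) \<Rightarrow> ((real^'m) \<times> (real^'n) \<Rightarrow> real) \<Rightarrow> real" where
  "dual_obj \<mu> \<nu> \<epsilon> f g h =
     (LINT u:msupport \<mu>|\<mu>. f u) + (LINT z:X_supp \<nu> \<times> Y_supp \<nu>|\<nu>. h z)
     - \<epsilon> * ((LINT w:msupport \<mu> \<times> (X_supp \<nu> \<times> Y_supp \<nu>)|(\<mu> \<Otimes>\<^sub>M \<nu>).
               (case w of (u, x, y) \<Rightarrow> exp ((f u + g u \<bullet> x + h (x, y) - cost u y) / \<epsilon>))) - 1)"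

definition h_update ::
    "(real^'n) measure \<Rightarrow> real \<Rightarrow> (real^'n \<Rightarrow> real) \<Rightarrow> (real^'n \<Rightarrow> real^'m) \<Rightarrow>
     (real^'m) \<times> (real^'n) \<Rightarrow> real" where
  "h_update \<mu> \<epsilon> f g = (\<lambda>(x, y).
     - \<epsilon> * ln (LINT u:msupport \<mu>|\<mu>. exp ((f u + g u \<bullet> x - cost u y) / \<epsilon>)))"

definition f_update ::
    "((real^'m) \<times> (real^'n)) measure \<Rightarrow> real \<Rightarrow> (real^'n \<Rightarrow> real^'m) \<Rightarrow>
     ((real^'m) \<times> (real^'n) \<Rightarrow> real) \<Rightarrow> real^'n \<Rightarrow> real" where
  "f_update \<nu> \<epsilon> g h u =
     - \<epsilon> * ln (LINT z:X_supp \<nu> \<times> Y_supp \<nu>|\<nu>.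
                (case z of (x, y) \<Rightarrow> exp ((g u \<bullet> x + h (x, y) - cost u y) / \<epsilon>)))"

definition g_direction ::
    "((real^'m) \<times> (real^'n)) measure \<Rightarrow> real \<Rightarrow> (real^'n \<Rightarrow> real) \<Rightarrow> (real^'n \<Rightarrow> real^'m) \<Rightarrow>
     ((real^'m) \<times> (real^'n) \<Rightarrow> real) \<Rightarrow> real^'n \<Rightarrow> real^'m" where
  "g_direction \<nu> \<epsilon> f g h u =
     exp (f u / \<epsilon>) *\<^sub>R (LINT z:X_supp \<nu> \<times> Y_supp \<nu>|\<nu>.
                (case z of (x, y) \<Rightarrow> exp ((g u \<bullet> x + h (x, y) - cost u y) / \<epsilon>) *\<^sub>R x))"

text \<open>
  The intermediate iterates \<open>ft\<close>, \<open>gt\<close>, \<open>ht\<close> (the ones written with a tilde) are only constrained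
  at positive indices.
\<close>

definition modified_sinkhorn ::
    "(real^'n) measure \<Rightarrow> ((real^'m) \<times> (real^'n)) measure \<Rightarrow> real \<Rightarrow> real \<Rightarrow>
     (nat \<Rightarrow> real^'n \<Rightarrow> real) \<Rightarrow> (nat \<Rightarrow> real^'n \<Rightarrow> real^'m) \<Rightarrow> (nat \<Rightarrow> (real^'m) \<times> (real^'n) \<Rightarrow> real) \<Rightarrow>
     (nat \<Rightarrow> real^'n \<Rightarrow> real) \<Rightarrow> (nat \<Rightarrow> real^'n \<Rightarrow> real^'m) \<Rightarrow> (nat \<Rightarrow> (real^'m) \<times> (real^'n) \<Rightarrow> real) \<Rightarrow>
     bool" where
  "modified_sinkhorn \<mu> \<nu> \<epsilon> \<eta> f g h ft gt ht \<longleftrightarrow>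
     (\<forall>t.
       (\<forall>z \<in> X_supp \<nu> \<times> Y_supp \<nu>. ht (Suc t) z = h_update \<mu> \<epsilon> (f t) (g t) z) \<and>
       (\<forall>u \<in> msupport \<mu>. ft (Suc t) u = f_update \<nu> \<epsilon> (g t) (ht (Suc t)) u) \<and>
       (\<forall>u \<in> msupport \<mu>.
          gt (Suc t) u = g t u - \<eta> *\<^sub>R g_direction \<nu> \<epsilon> (ft (Suc t)) (g t) (ht (Suc t)) u) \<and>
       (\<forall>u \<in> msupport \<mu>. f (Suc t) u = ft (Suc t) u - (LINT v:msupport \<mu>|\<mu>. ft (Suc t) v)) \<and>
       (\<forall>u \<in> msupport \<mu>. g (Suc t) u = gt (Suc t) u - (LINT v:msupport \<mu>|\<mu>. gt (Suc t) v)) \<and>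
       (\<forall>x \<in> X_supp \<nu>. \<forall>y \<in> Y_supp \<nu>.
          h (Suc t) (x, y) = ht (Suc t) (x, y) + (LINT v:msupport \<mu>|\<mu>. ft (Suc t) v)
                             + (LINT v:msupport \<mu>|\<mu>. gt (Suc t) v) \<bullet> x))"

end

theory Submission
  imports Defs
begin

text \<open>
  For fixed \<open>f, g\<close> the objective is \<open>\<integral> (h - \<epsilon> exp ((h - h~) / \<epsilon>)) d\<nu>\<close> up to a constant, where \<open>h~\<close> is
  the \<open>h\<close>-update, and \<open>1 + s \<le> exp s\<close> shows that \<open>h = h~\<close> is optimal; the \<open>f\<close>-update is treated in the
  same way.  After the \<open>f\<close>-update the Gibbs kernel is, for each \<open>u\<close>, a probability density with respect
  to \<open>\<nu>\<close>, and \<open>d u\<close> is the mean of \<open>x\<close> under it.  The gradient step multiplies the kernel by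
  \<open>exp (- (\<eta> / \<epsilon>) * (d u \<bullet> x))\<close>, whose mean is at most
  \<open>exp (- (\<eta> / \<epsilon>) * |d u|\<^sup>2 + (\<eta> / \<epsilon>)\<^sup>2 * M\<^sup>2 * |d u|\<^sup>2 / 2)\<close> by Hoeffding's lemma, hence at most \<open>1\<close> for the
  admissible step sizes.  The final recentring leaves the exponent unchanged, and \<open>E X = 0\<close> makes
  the linear terms cancel.
\<close>

section \<open>Probability measures concentrated on a compact set\<close>

text \<open>By the Lindelof property the union of all open null sets is already a countable union of
  them, hence null; its complement is the support.\<close>

lemma AE_in_msupport:
  fixes M :: "'a::second_countable_topology measure"
  assumes "sets M = sets borel"
  shows "AE x in M. x \<in> msupport M"
proof -
  obtain \<F> where \<F>: "\<F> \<subseteq> {V. open V \<and> emeasure M V = 0}" "countable \<F>"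
      "\<Union>\<F> = \<Union>{V. open V \<and> emeasure M V = 0}"
    using Lindelof[of "{V. open V \<and> emeasure M V = 0}"] by blast
  have "AE x in M. \<forall>V\<in>\<F>. x \<notin> V"
  proof (subst AE_ball_countable[OF \<F>(2)], intro ballI)
    fix V assume "V \<in> \<F>"
    then have "V \<in> null_sets M"
      using \<F>(1) assms by (auto simp: null_sets_def)
    then show "AE x in M. x \<notin> V"
      by (rule AE_not_in)
  qed
  then show ?thesis
  proof eventually_elim
    case (elim x)
    then have "x \<notin> \<Union>{V. open V \<and> emeasure M V = 0}"
      using \<F>(3) by blast
    then show ?case
      by (auto simp: msupport_def zero_less_iff_neq_zero)
  qed
qed

text \<open>\<open>K\<close> is only required to be a compact set of full measure, so that it may
  also be a product of marginal supports, which can exceed the support of the joint law.\<close>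

locale compact_prob_space = prob_space M
  for M :: "'a::{second_countable_topology, t2_space} measure" +
  fixes K :: "'a set"
  assumes sets_M [measurable_cong]: "sets M = sets borel"
    and compact_K: "compact K"
    and AE_K: "AE x in M. x \<in> K"
begin

section \<open>Integrals of functions that are continuous on \<open>K\<close>\<close>

lemma K_sets [measurable, simp]: "K \<in> sets M"
  using compact_K sets_M by (simp add: borel_compact)

lemma K_borel [simp]: "K \<in> sets borel"
  using K_sets sets_M by simp

lemma borel_measurable_indicator_continuous:
  fixes \<phi> :: "'a \<Rightarrow> 'b::real_normed_vector"
  assumes "continuous_on K \<phi>"
  shows "(\<lambda>x. indicator K x *\<^sub>R \<phi> x) \<in> borel_measurable M"
  using borel_measurable_continuous_on_indicator[OF K_borel assms]
  by (simp add: measurable_cong_sets[OF sets_M refl])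

lemma set_integrable_continuous:
  fixes \<phi> :: "'a \<Rightarrow> 'b::{banach, second_countable_topology}"
  assumes "continuous_on K \<phi>"
  shows "set_integrable M K \<phi>"
proof -
  obtain B where B: "\<forall>x\<in>K. norm (\<phi> x) \<le> B"
    using compact_imp_bounded[OF compact_continuous_image[OF assms compact_K]]
    by (auto simp: bounded_iff)
  have "AE x in M. norm (indicator K x *\<^sub>R \<phi> x) \<le> B"
    using AE_K by eventually_elim (use B in auto)
  then show ?thesis
    unfolding set_integrable_def
    using borel_measurable_indicator_continuous[OF assms] by (rule integrable_const_bound)
qed

lemma set_integral_eq_integral:
  fixes \<phi> :: "'a \<Rightarrow> 'b::{banach, second_countable_topology}"
  assumes "\<phi> \<in> borel_measurable M"
  shows "(LINT x:K|M. \<phi> x) = (LINT x|M. \<phi> x)"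
  unfolding set_lebesgue_integral_def
  using AE_K assms by (intro integral_cong_AE) (auto elim: eventually_mono)

lemma set_integral_const_K [simp]:
  "(LINT x:K|M. c) = (c :: 'b::{banach, second_countable_topology})"
  using set_integral_eq_integral[of "\<lambda>_. c"] by (simp add: prob_space)

text \<open>The integrand is strictly positive on a set of full measure. This makes the logarithms
  in the updates genuine ones.\<close>

lemma set_integral_exp_pos:
  fixes \<phi> :: "'a \<Rightarrow> real"
  assumes "continuous_on K \<phi>"
  shows "0 < (LINT x:K|M. exp (\<phi> x))"
proof -
  have "integrable M (\<lambda>x. indicator K x *\<^sub>R exp (\<phi> x))"
    using set_integrable_continuous[of "\<lambda>x. exp (\<phi> x)"] assms
    by (simp add: set_integrable_def continuous_on_exp)
  moreover have "AE x in M. 0 < indicator K x *\<^sub>R exp (\<phi> x)"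
    using AE_K by eventually_elim auto
  ultimately show ?thesis
    unfolding set_lebesgue_integral_def
    using integral_less_AE_space[of "\<lambda>_. 0"] emeasure_space_1 by fastforce
qed

text \<open>Dominated convergence along sequences: \<open>F\<close> is bounded on the compact set
  \<open>S \<times> K\<close>, and a constant is integrable for a probability measure.\<close>

lemma continuous_on_set_integral:
  fixes F :: "'c::{first_countable_topology, t2_space} \<Rightarrow> 'a \<Rightarrow> 'b::{banach, second_countable_topology}"
  assumes "compact S" and F: "continuous_on (S \<times> K) (\<lambda>(s, x). F s x)"
  shows "continuous_on S (\<lambda>s. LINT x:K|M. F s x)"
proof (rule continuous_on_sequentiallyI)
  fix s :: "nat \<Rightarrow> 'c" and a
  assume s: "\<forall>n. s n \<in> S" and a: "a \<in> S" and lim: "s \<longlonglongrightarrow> a"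
  have slice: "continuous_on K (F b)" if "b \<in> S" for b
  proof -
    have "continuous_on K (\<lambda>x. case (b, x) of (s, x) \<Rightarrow> F s x)"
      by (rule continuous_on_compose2[OF F]) (use that in \<open>auto intro: continuous_on_Pair\<close>)
    then show ?thesis
      by simp
  qed
  obtain B where B: "\<forall>p\<in>S \<times> K. norm ((\<lambda>(s, x). F s x) p) \<le> B"
    using compact_imp_bounded[OF compact_continuous_image[OF F compact_Times[OF assms(1) compact_K]]]
    by (auto simp: bounded_iff)
  show "(\<lambda>n. LINT x:K|M. F (s n) x) \<longlonglongrightarrow> (LINT x:K|M. F a x)"
    unfolding set_lebesgue_integral_def
  proof (rule integral_dominated_convergence[where w = "\<lambda>_. B"])
    show "AE x in M. (\<lambda>n. indicator K x *\<^sub>R F (s n) x) \<longlonglongrightarrow> indicator K x *\<^sub>R F a x"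
      using AE_K
    proof eventually_elim
      case (elim x)
      have "continuous_on S (\<lambda>s. case (s, x) of (s, x) \<Rightarrow> F s x)"
        by (rule continuous_on_compose2[OF F]) (use elim in \<open>auto intro: continuous_on_Pair\<close>)
      then have "(\<lambda>n. F (s n) x) \<longlonglongrightarrow> F a x"
        using s a lim unfolding continuous_on_sequentially by (auto simp: o_def)
      then show ?case
        by (intro tendsto_intros)
    qed
    show "AE x in M. norm (indicator K x *\<^sub>R F (s n) x) \<le> B" for n
      using AE_K by eventually_elim (use B s in auto)
  qed (use slice s a in \<open>auto intro!: borel_measurable_indicator_continuous\<close>)
qed

section \<open>Two exponential inequalities: one for exact maximisation, one for the gradient
  step\<close>

text \<open>Pointwise, \<open>a - \<epsilon> * exp ((a - b) / \<epsilon>)\<close> is maximal in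
  \<open>a\<close> at \<open>a = b\<close>, with value \<open>b - \<epsilon>\<close>; this is
  \<open>1 + s \<le> exp s\<close> at \<open>s = (a - b) / \<epsilon>\<close>, times
  \<open>\<epsilon>\<close>.\<close>

lemma set_integral_exp_diff_le:
  fixes \<phi> \<psi> :: "'a \<Rightarrow> real"
  assumes \<phi>: "continuous_on K \<phi>" and \<psi>: "continuous_on K \<psi>" and "0 < \<epsilon>"
  shows "(LINT x:K|M. \<phi> x) - \<epsilon> * (LINT x:K|M. exp ((\<phi> x - \<psi> x) / \<epsilon>)) \<le> (LINT x:K|M. \<psi> x) - \<epsilon>"
proof -
  have int: "set_integrable M K \<phi>" "set_integrable M K \<psi>"
    "set_integrable M K (\<lambda>x. \<epsilon> * exp ((\<phi> x - \<psi> x) / \<epsilon>))"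
    using assms by (auto intro!: set_integrable_continuous continuous_intros)
  have "\<phi> x - \<epsilon> * exp ((\<phi> x - \<psi> x) / \<epsilon>) \<le> \<psi> x - \<epsilon>" for x
    using mult_left_mono[OF exp_ge_add_one_self[of "(\<phi> x - \<psi> x) / \<epsilon>"], of \<epsilon>] \<open>0 < \<epsilon>\<close>
    by (simp add: distrib_left)
  then have "(LINT x:K|M. \<phi> x - \<epsilon> * exp ((\<phi> x - \<psi> x) / \<epsilon>)) \<le> (LINT x:K|M. \<psi> x - \<epsilon>)"
    using int by (intro set_integral_mono set_integral_diff set_integrable_continuous continuous_intros \<phi> \<psi>)
      (use assms in auto)
  then show ?thesis
    using int by (simp add: set_integral_diff(2) set_integrable_continuous)
qed

text \<open>Hoeffding's lemma under the tilted law with density \<open>p\<close>: the variable \<open>- (m \<bullet> X)\<close> has mean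
  \<open>- (m \<bullet> m)\<close> and takes values in an interval of length \<open>2 * B * norm m\<close>.\<close>

lemma set_integral_exp_mean_le_one:
  fixes p :: "'a \<Rightarrow> real" and X :: "'a \<Rightarrow> 'b::euclidean_space"
  assumes p: "continuous_on K p" and p_pos: "\<And>x. x \<in> K \<Longrightarrow> 0 \<le> p x"
    and p1: "(LINT x:K|M. p x) = 1"
    and X: "continuous_on K X" and XB: "\<And>x. x \<in> K \<Longrightarrow> norm (X x) \<le> B"
    and s: "0 < s" "s * B\<^sup>2 \<le> 2"
    and m: "m = (LINT x:K|M. p x *\<^sub>R X x)"
  shows "(LINT x:K|M. p x * exp (- s * (m \<bullet> X x))) \<le> 1"
proof -
  \<comment> \<open>Cutting off outside \<open>K\<close> yields globally measurable functions,
    whatever \<open>p\<close> and \<open>X\<close> do there.\<close>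
  define q where "q x = indicator K x *\<^sub>R p x" for x
  define Y where "Y x = indicator K x *\<^sub>R (- (m \<bullet> X x))" for x
  have q_meas [measurable]: "q \<in> borel_measurable M"
    unfolding q_def by (intro borel_measurable_indicator_continuous p)
  have Y_meas [measurable]: "Y \<in> borel_measurable M"
    unfolding Y_def by (intro borel_measurable_indicator_continuous continuous_intros X)
  have q_pos: "0 \<le> q x" for x
    using p_pos by (auto simp: q_def indicator_def)
  have q_int: "integrable M q"
    using set_integrable_continuous[OF p] by (simp add: q_def[abs_def] set_integrable_def)
  interpret Q: prob_space "density M q"
  proof
    have "(\<integral>\<^sup>+ x. ennreal (q x) \<partial>M) = ennreal (LINT x|M. q x)"
      using q_int q_pos by (intro nn_integral_eq_integral) auto
    also have "\<dots> = 1"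
      using p1 by (simp add: q_def set_lebesgue_integral_def)
    finally show "emeasure (density M q) (space (density M q)) = 1"
      by (simp add: emeasure_density cong: nn_integral_cong)
  qed
  have Y_bound: "Y x \<in> {- (B * norm m)..B * norm m}" if "x \<in> K" for x
  proof -
    have "\<bar>m \<bullet> X x\<bar> \<le> norm m * norm (X x)"
      by (rule Cauchy_Schwarz_ineq2)
    also have "\<dots> \<le> norm m * B"
      using XB[OF that] by (intro mult_left_mono) auto
    finally show ?thesis
      using that by (auto simp: Y_def mult.commute)
  qed
  interpret Y: interval_bounded_random_variable "density M q" Y "- (B * norm m)" "B * norm m"
  proof
    show "Y \<in> borel_measurable (density M q)"
      by simp
    show "AE x in density M q. Y x \<in> {- (B * norm m)..B * norm m}"
      using AE_K Y_bound by (auto simp: AE_density elim: eventually_mono)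
  qed
  have "Q.expectation Y = (LINT x|M. q x * Y x)"
    using q_pos by (subst integral_density) auto
  also have "\<dots> = (LINT x:K|M. - m \<bullet> (p x *\<^sub>R X x))"
    unfolding set_lebesgue_integral_def
    by (intro Bochner_Integration.integral_cong) (auto simp: q_def Y_def indicator_def)
  also have "\<dots> = (LINT x|M. - m \<bullet> (indicator K x *\<^sub>R (p x *\<^sub>R X x)))"
    unfolding set_lebesgue_integral_def by (simp add: inner_scaleR_right mult.assoc)
  also have "\<dots> = - m \<bullet> m"
    using set_integrable_continuous[of "\<lambda>x. p x *\<^sub>R X x"] p X
    unfolding m set_lebesgue_integral_def set_integrable_def
    by (subst integral_inner_right) (auto intro!: continuous_intros)
  finally have EY: "Q.expectation Y = - (norm m)\<^sup>2"
    by (simp add: power2_norm_eq_inner)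
  have exp_int: "set_integrable M K (\<lambda>x. p x * exp (- s * (m \<bullet> X x)))"
    by (intro set_integrable_continuous continuous_intros p X)
  \<comment> \<open>Hoeffding's lemma is applied in its nonnegative-integral form, so the integral
    is first moved to \<open>ennreal\<close> and then to the tilted law.\<close>
  have "ennreal (LINT x:K|M. p x * exp (- s * (m \<bullet> X x)))
      = (\<integral>\<^sup>+ x. ennreal (indicator K x *\<^sub>R (p x * exp (- s * (m \<bullet> X x)))) \<partial>M)"
    using exp_int p_pos unfolding set_lebesgue_integral_def set_integrable_def
    by (subst nn_integral_eq_integral) (auto simp: indicator_def)
  also have "\<dots> = (\<integral>\<^sup>+ x. ennreal (q x) * ennreal (exp (s * Y x)) \<partial>M)"
    using q_pos
    by (intro nn_integral_cong) (auto simp: q_def Y_def indicator_def ennreal_mult p_pos)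
  also have "\<dots> = (\<integral>\<^sup>+ x. ennreal (exp (s * Y x)) \<partial>density M q)"
    by (subst nn_integral_density) auto
  \<comment> \<open>Centring \<open>Y\<close> splits off the factor
    \<open>exp (s * Q.expectation Y)\<close>, which supplies the negative term of the
    exponent.\<close>
  also have "\<dots> = (\<integral>\<^sup>+ x. ennreal (exp (- s * (norm m)\<^sup>2))
      * ennreal (exp (s * (Y x - Q.expectation Y))) \<partial>density M q)"
    by (intro nn_integral_cong) (simp add: EY flip: ennreal_mult exp_add, simp add: algebra_simps)
  also have "\<dots> = ennreal (exp (- s * (norm m)\<^sup>2))
      * (\<integral>\<^sup>+ x. ennreal (exp (s * (Y x - Q.expectation Y))) \<partial>density M q)"
    by (intro nn_integral_cmult) simp
  also have "\<dots> \<le> ennreal (exp (- s * (norm m)\<^sup>2))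
      * ennreal (exp (s\<^sup>2 * (B * norm m - - (B * norm m))\<^sup>2 / 8))"
    by (intro mult_left_mono Y.Hoeffdings_lemma_nn_integral s) auto
  \<comment> \<open>The squared length of the interval is
    \<open>4 * B\<^sup>2 * (norm m)\<^sup>2\<close>, so the two exponents share the factor
    \<open>s * (norm m)\<^sup>2 / 2\<close>; the sign is then decided by
    \<open>s * B\<^sup>2 \<le> 2\<close>.\<close>
  also have "\<dots> = ennreal (exp ((s * (norm m)\<^sup>2 / 2) * (s * B\<^sup>2 - 2)))"
    by (simp flip: ennreal_mult exp_add) (simp add: power2_eq_square algebra_simps)
  also have "\<dots> \<le> 1"
    using s by (simp add: mult_nonneg_nonpos)
  finally show ?thesis
    by simp
qed

end

section \<open>Products and Fubini's theorem\<close>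

locale pair_compact_prob_space = M1: compact_prob_space M1 K1 + M2: compact_prob_space M2 K2
  for M1 :: "'a::{second_countable_topology, t2_space} measure" and K1
    and M2 :: "'b::{second_countable_topology, t2_space} measure" and K2
begin

sublocale pair_prob_space M1 M2 ..

sublocale pair: compact_prob_space "M1 \<Otimes>\<^sub>M M2" "K1 \<times> K2"
proof
  show "sets (M1 \<Otimes>\<^sub>M M2) = sets borel"
    using sets_pair_measure_cong[OF M1.sets_M M2.sets_M] by (simp add: borel_prod[symmetric])
  show "compact (K1 \<times> K2)"
    by (intro compact_Times M1.compact_K M2.compact_K)
  show "AE x in M1 \<Otimes>\<^sub>M M2. x \<in> K1 \<times> K2"
  proof (rule AE_pair_measure)
    have "K1 \<times> K2 \<in> sets (M1 \<Otimes>\<^sub>M M2)"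
      by (intro pair_measureI) simp_all
    then show "{x \<in> space (M1 \<Otimes>\<^sub>M M2). x \<in> K1 \<times> K2} \<in> sets (M1 \<Otimes>\<^sub>M M2)"
      by (simp add: Collect_conj_eq)
    show "AE x in M1. AE y in M2. (x, y) \<in> K1 \<times> K2"
      using M1.AE_K
    proof eventually_elim
      case (elim x)
      show ?case
        using M2.AE_K by eventually_elim (use elim in auto)
    qed
  qed
qed

text \<open>Continuity on the compact product gives integrability. This order of integration serves
  the \<open>f\<close>-update and the gradient step, the opposite order the
  \<open>h\<close>-update.\<close>

lemma set_integral_pair_fst:
  fixes F :: "'a \<times> 'b \<Rightarrow> 'c::{banach, second_countable_topology}"
  assumes "continuous_on (K1 \<times> K2) F"
  shows "(LINT w:K1 \<times> K2|M1 \<Otimes>\<^sub>M M2. F w) = (LINT x:K1|M1. LINT y:K2|M2. F (x, y))"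
  using integral_fst'[of "\<lambda>w. indicator (K1 \<times> K2) w *\<^sub>R F w"]
    pair.set_integrable_continuous[OF assms]
  by (simp add: set_lebesgue_integral_def set_integrable_def indicator_times flip: scaleR_scaleR)

lemma set_integral_pair_snd:
  fixes F :: "'a \<times> 'b \<Rightarrow> 'c::{banach, second_countable_topology}"
  assumes "continuous_on (K1 \<times> K2) F"
  shows "(LINT w:K1 \<times> K2|M1 \<Otimes>\<^sub>M M2. F w) = (LINT y:K2|M2. LINT x:K1|M1. F (x, y))"
proof -
  let ?F = "\<lambda>w. indicator (K1 \<times> K2) w *\<^sub>R F w"
  have int: "integrable (M1 \<Otimes>\<^sub>M M2) ?F"
    using pair.set_integrable_continuous[OF assms] by (simp add: set_integrable_def)
  have "(LINT w:K1 \<times> K2|M1 \<Otimes>\<^sub>M M2. F w) = (LINT y|M2. LINT x|M1. ?F (x, y))"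
    using Fubini_integral[of "\<lambda>x y. ?F (x, y)"] integral_fst'[OF int] int
    by (simp add: set_lebesgue_integral_def split_beta' del: indicator_times)
  also have "\<dots> = (LINT y:K2|M2. LINT x:K1|M1. F (x, y))"
    unfolding set_lebesgue_integral_def
    by (intro Bochner_Integration.integral_cong refl) (auto simp: indicator_def)
  finally show ?thesis .
qed

end

section \<open>The modified Sinkhorn steps\<close>

locale sinkhorn_setting =
  fixes \<mu> :: "(real^'n) measure" and \<nu> :: "((real^'m) \<times> (real^'n)) measure" and \<epsilon> :: real
  assumes prob_\<mu>: "prob_space \<mu>" and sets_\<mu>: "sets \<mu> = sets borel"
    and prob_\<nu>: "prob_space \<nu>" and sets_\<nu>: "sets \<nu> = sets borel"
    and compact_U: "compact (msupport \<mu>)"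
    and compact_X: "compact (X_supp \<nu>)" and compact_Y: "compact (Y_supp \<nu>)"
    and \<epsilon>_pos: "0 < \<epsilon>"
begin

abbreviation U where "U \<equiv> msupport \<mu>"

abbreviation Z where "Z \<equiv> X_supp \<nu> \<times> Y_supp \<nu>"

text \<open>Each coordinate lies almost surely in the support of its marginal; the two statements
  are pulled back along the projections and intersected.\<close>

lemma AE_Z: "AE z in \<nu>. z \<in> Z"
proof -
  have fst: "fst \<in> \<nu> \<rightarrow>\<^sub>M borel" and snd: "snd \<in> \<nu> \<rightarrow>\<^sub>M borel"
    by (auto simp: measurable_cong_sets[OF sets_\<nu> refl]
        intro!: borel_measurable_continuous_onI continuous_intros)
  have "AE z in \<nu>. fst z \<in> X_supp \<nu>"
    using AE_in_msupport[of "distr \<nu> borel fst"] AE_distr_iff[OF fst, of "\<lambda>x. x \<in> X_supp \<nu>"] compact_X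
    by (simp add: X_supp_def[symmetric] borel_compact)
  moreover have "AE z in \<nu>. snd z \<in> Y_supp \<nu>"
    using AE_in_msupport[of "distr \<nu> borel snd"] AE_distr_iff[OF snd, of "\<lambda>x. x \<in> Y_supp \<nu>"] compact_Y
    by (simp add: Y_supp_def[symmetric] borel_compact)
  ultimately show ?thesis
    by eventually_elim (simp add: mem_Times_iff)
qed

sublocale pair_compact_prob_space \<mu> U \<nu> Z
proof -
  interpret \<mu>: prob_space \<mu> by (rule prob_\<mu>)
  interpret \<nu>: prob_space \<nu> by (rule prob_\<nu>)
  show "pair_compact_prob_space \<mu> U \<nu> Z"
    by unfold_locales
      (auto simp: sets_\<mu> sets_\<nu> compact_U compact_X compact_Y compact_Times AE_in_msupport AE_Z)
qed

section \<open>The Gibbs kernel and continuity of the updates\<close>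

text \<open>Unnormalised density of a coupling with respect to
  \<open>\<mu> \<Otimes>\<^sub>M \<nu>\<close>. Putting \<open>f\<close> or \<open>h\<close> to zero
  recovers the integrands of the updates, so one continuity proof covers them all.\<close>

definition gibbs ::
    "(real^'n \<Rightarrow> real) \<Rightarrow> (real^'n \<Rightarrow> real^'m) \<Rightarrow> ((real^'m) \<times> (real^'n) \<Rightarrow> real) \<Rightarrow>
     (real^'n) \<times> (real^'m) \<times> (real^'n) \<Rightarrow> real" where
  "gibbs f g h = (\<lambda>(u, z). exp ((f u + g u \<bullet> fst z + h z - cost u (snd z)) / \<epsilon>))"

lemma dual_obj_gibbs:
  "dual_obj \<mu> \<nu> \<epsilon> f g h = (LINT u:U|\<mu>. f u) + (LINT z:Z|\<nu>. h z)
     - \<epsilon> * ((LINT w:U \<times> Z|\<mu> \<Otimes>\<^sub>M \<nu>. gibbs f g h w) - 1)"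
  by (simp add: dual_obj_def gibbs_def split_beta')

lemma continuous_on_gibbs:
  assumes "continuous_on U f" "continuous_on U g" "continuous_on Z h"
  shows "continuous_on (U \<times> Z) (gibbs f g h)"
  unfolding gibbs_def split_beta' cost_def
  by (intro continuous_intros continuous_on_compose2[OF assms(1)] continuous_on_compose2[OF assms(2)]
      continuous_on_compose2[OF assms(3)]) (use \<epsilon>_pos in auto)

lemma h_update_gibbs: "h_update \<mu> \<epsilon> f g z = - \<epsilon> * ln (LINT u:U|\<mu>. gibbs f g (\<lambda>_. 0) (u, z))"
  by (simp add: h_update_def gibbs_def split_beta')

lemma f_update_gibbs: "f_update \<nu> \<epsilon> g h u = - \<epsilon> * ln (LINT z:Z|\<nu>. gibbs (\<lambda>_. 0) g h (u, z))"
  by (simp add: f_update_def gibbs_def split_beta')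

lemma g_direction_gibbs:
  "g_direction \<nu> \<epsilon> f g h u = exp (f u / \<epsilon>) *\<^sub>R (LINT z:Z|\<nu>. gibbs (\<lambda>_. 0) g h (u, z) *\<^sub>R fst z)"
  by (simp add: g_direction_def gibbs_def split_beta')

lemma gibbs_split_h: "gibbs f g h (u, z) = exp (h z / \<epsilon>) * gibbs f g (\<lambda>_. 0) (u, z)"
  by (simp add: gibbs_def add_divide_distrib diff_divide_distrib flip: exp_add)

lemma gibbs_split_f: "gibbs f g h (u, z) = exp (f u / \<epsilon>) * gibbs (\<lambda>_. 0) g h (u, z)"
  by (simp add: gibbs_def add_divide_distrib diff_divide_distrib flip: exp_add)

lemma continuous_on_gibbs_fst:
  assumes "continuous_on U f" "continuous_on U g" "continuous_on Z h" "z \<in> Z"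
  shows "continuous_on U (\<lambda>u. gibbs f g h (u, z))"
  by (rule continuous_on_compose2[OF continuous_on_gibbs[OF assms(1-3)]])
    (use assms(4) in \<open>auto intro: continuous_on_Pair\<close>)

lemma continuous_on_gibbs_snd:
  assumes "continuous_on U f" "continuous_on U g" "continuous_on Z h" "u \<in> U"
  shows "continuous_on Z (\<lambda>z. gibbs f g h (u, z))"
  by (rule continuous_on_compose2[OF continuous_on_gibbs[OF assms(1-3)]])
    (use assms(4) in \<open>auto intro: continuous_on_Pair\<close>)

lemma gibbs_integral_fst_pos:
  assumes "continuous_on U f" "continuous_on U g" "continuous_on Z h" "z \<in> Z"
  shows "0 < (LINT u:U|\<mu>. gibbs f g h (u, z))"
proof -
  \<comment> \<open>The exponent is recovered as the logarithm of the kernel, so that its continuity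
    is inherited from the kernel.\<close>
  have "continuous_on U (\<lambda>u. ln (gibbs f g h (u, z)))"
    using continuous_on_gibbs_fst[OF assms]
    by (intro continuous_on_ln) (auto simp: gibbs_def)
  from M1.set_integral_exp_pos[OF this] show ?thesis
    by (simp add: gibbs_def)
qed

lemma gibbs_integral_snd_pos:
  assumes "continuous_on U f" "continuous_on U g" "continuous_on Z h" "u \<in> U"
  shows "0 < (LINT z:Z|\<nu>. gibbs f g h (u, z))"
proof -
  have "continuous_on Z (\<lambda>z. ln (gibbs f g h (u, z)))"
    using continuous_on_gibbs_snd[OF assms]
    by (intro continuous_on_ln) (auto simp: gibbs_def)
  from M2.set_integral_exp_pos[OF this] show ?thesis
    by (simp add: gibbs_def)
qed

lemma compact_Z: "compact Z"
  by (intro compact_Times compact_X compact_Y)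

lemma continuous_on_h_update:
  assumes "continuous_on U f" "continuous_on U g"
  shows "continuous_on Z (h_update \<mu> \<epsilon> f g)"
proof -
  have "continuous_on (Z \<times> U) (\<lambda>(z, u). gibbs f g (\<lambda>_. 0) (u, z))"
    unfolding split_beta'
    by (intro continuous_on_compose2[OF continuous_on_gibbs[OF assms continuous_on_const]])
      (auto intro!: continuous_intros)
  note cont = M1.continuous_on_set_integral[OF compact_Z this]
  have "\<forall>z\<in>Z. (LINT u:U|\<mu>. gibbs f g (\<lambda>_. 0) (u, z)) \<noteq> 0"
    using gibbs_integral_fst_pos[OF assms continuous_on_const[of _ 0]] by (metis less_irrefl)
  then show ?thesis
    unfolding h_update_gibbs by (intro continuous_intros cont)
qed

lemma continuous_on_f_update:
  assumes "continuous_on U g" "continuous_on Z h"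
  shows "continuous_on U (f_update \<nu> \<epsilon> g h)"
proof -
  have "continuous_on (U \<times> Z) (\<lambda>(u, z). gibbs (\<lambda>_. 0) g h (u, z))"
    using continuous_on_gibbs[OF continuous_on_const assms] by (simp add: split_beta')
  note cont = M2.continuous_on_set_integral[OF compact_U this]
  have "\<forall>u\<in>U. (LINT z:Z|\<nu>. gibbs (\<lambda>_. 0) g h (u, z)) \<noteq> 0"
    using gibbs_integral_snd_pos[OF continuous_on_const[of _ 0] assms] by (metis less_irrefl)
  then show ?thesis
    unfolding f_update_gibbs by (intro continuous_intros cont)
qed

lemma continuous_on_g_direction:
  assumes "continuous_on U f" "continuous_on U g" "continuous_on Z h"
  shows "continuous_on U (g_direction \<nu> \<epsilon> f g h)"
proof -
  have "continuous_on (U \<times> Z) (\<lambda>(u, z). gibbs (\<lambda>_. 0) g h (u, z) *\<^sub>R fst z)"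
    using continuous_on_gibbs[OF continuous_on_const assms(2,3)]
    by (auto simp: split_beta' intro!: continuous_intros)
  from M2.continuous_on_set_integral[OF compact_U this] show ?thesis
    unfolding g_direction_gibbs
    using \<epsilon>_pos by (intro continuous_intros assms) auto
qed

section \<open>Ascent in each of the three potentials\<close>

text \<open>Integrating out \<open>u\<close> leaves \<open>exp (h z / \<epsilon>)\<close> times the
  integral whose logarithm defines the update. This isolates the dependence on \<open>h\<close> in
  the form treated by \<open>set_integral_exp_diff_le\<close>.\<close>

lemma dual_obj_h:
  assumes "continuous_on U f" "continuous_on U g" "continuous_on Z h"
  shows "dual_obj \<mu> \<nu> \<epsilon> f g h = (LINT u:U|\<mu>. f u) + \<epsilon> + ((LINT z:Z|\<nu>. h z)
     - \<epsilon> * (LINT z:Z|\<nu>. exp ((h z - h_update \<mu> \<epsilon> f g z) / \<epsilon>)))"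
proof -
  have "(LINT w:U \<times> Z|\<mu> \<Otimes>\<^sub>M \<nu>. gibbs f g h w) = (LINT z:Z|\<nu>. LINT u:U|\<mu>. gibbs f g h (u, z))"
    by (rule set_integral_pair_snd[OF continuous_on_gibbs[OF assms]])
  also have "\<dots> = (LINT z:Z|\<nu>. exp ((h z - h_update \<mu> \<epsilon> f g z) / \<epsilon>))"
  proof (rule set_lebesgue_integral_cong, simp, intro allI impI)
    fix z assume "z \<in> Z"
    then show "(LINT u:U|\<mu>. gibbs f g h (u, z)) = exp ((h z - h_update \<mu> \<epsilon> f g z) / \<epsilon>)"
      using gibbs_integral_fst_pos[OF assms(1,2) continuous_on_const[of _ 0]] \<epsilon>_pos
      by (subst gibbs_split_h) (simp add: h_update_gibbs add_divide_distrib exp_add)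
  qed
  finally show ?thesis
    by (simp add: dual_obj_gibbs algebra_simps)
qed

lemma dual_obj_f:
  assumes "continuous_on U f" "continuous_on U g" "continuous_on Z h"
  shows "dual_obj \<mu> \<nu> \<epsilon> f g h = (LINT z:Z|\<nu>. h z) + \<epsilon> + ((LINT u:U|\<mu>. f u)
     - \<epsilon> * (LINT u:U|\<mu>. exp ((f u - f_update \<nu> \<epsilon> g h u) / \<epsilon>)))"
proof -
  have "(LINT w:U \<times> Z|\<mu> \<Otimes>\<^sub>M \<nu>. gibbs f g h w) = (LINT u:U|\<mu>. LINT z:Z|\<nu>. gibbs f g h (u, z))"
    by (rule set_integral_pair_fst[OF continuous_on_gibbs[OF assms]])
  also have "\<dots> = (LINT u:U|\<mu>. exp ((f u - f_update \<nu> \<epsilon> g h u) / \<epsilon>))"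
  proof (rule set_lebesgue_integral_cong, simp, intro allI impI)
    fix u assume "u \<in> U"
    then show "(LINT z:Z|\<nu>. gibbs f g h (u, z)) = exp ((f u - f_update \<nu> \<epsilon> g h u) / \<epsilon>)"
      using gibbs_integral_snd_pos[OF continuous_on_const[of _ 0] assms(2,3)] \<epsilon>_pos
      by (subst gibbs_split_f) (simp add: f_update_gibbs add_divide_distrib exp_add)
  qed
  finally show ?thesis
    by (simp add: dual_obj_gibbs algebra_simps)
qed

text \<open>At the update the exponent in \<open>dual_obj_h\<close> vanishes and the exponential
  integrates to one, which is the equality case of the exponential inequality.\<close>

lemma dual_obj_le_h_update:
  assumes "continuous_on U f" "continuous_on U g" "continuous_on Z h"
  shows "dual_obj \<mu> \<nu> \<epsilon> f g h \<le> dual_obj \<mu> \<nu> \<epsilon> f g (h_update \<mu> \<epsilon> f g)"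
  using M2.set_integral_exp_diff_le[OF assms(3) continuous_on_h_update[OF assms(1,2)] \<epsilon>_pos]
  by (simp add: dual_obj_h assms continuous_on_h_update)

lemma dual_obj_le_f_update:
  assumes "continuous_on U f" "continuous_on U g" "continuous_on Z h"
  shows "dual_obj \<mu> \<nu> \<epsilon> f g h \<le> dual_obj \<mu> \<nu> \<epsilon> (f_update \<nu> \<epsilon> g h) g h"
  using M1.set_integral_exp_diff_le[OF assms(1) continuous_on_f_update[OF assms(2,3)] \<epsilon>_pos]
  by (simp add: dual_obj_f assms continuous_on_f_update)

lemma norm_le_M_x: "x \<in> X_supp \<nu> \<Longrightarrow> norm x \<le> M_x \<nu>"
  unfolding M_x_def
  by (intro cSUP_upper bounded_imp_bdd_above compact_imp_bounded compact_continuous_image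
      continuous_intros compact_X)

text \<open>A change of \<open>g\<close> affects the objective only through the total mass of the
  kernel. That mass is one for every \<open>u\<close> before the step and at most one after
  it.\<close>

lemma dual_obj_le_g_step:
  assumes g: "continuous_on U g" and h: "continuous_on Z h"
    and \<eta>: "0 < \<eta>" "\<eta> \<le> 2 * \<epsilon> / (M_x \<nu>)\<^sup>2"
  defines "f \<equiv> f_update \<nu> \<epsilon> g h"
  defines "g' \<equiv> \<lambda>u. g u - \<eta> *\<^sub>R g_direction \<nu> \<epsilon> f g h u"
  shows "dual_obj \<mu> \<nu> \<epsilon> f g h \<le> dual_obj \<mu> \<nu> \<epsilon> f g' h"
proof -
  have f: "continuous_on U f"
    unfolding f_def by (rule continuous_on_f_update[OF g h])
  have g': "continuous_on U g'"
    unfolding g'_def by (intro continuous_intros g continuous_on_g_direction f h)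
  \<comment> \<open>Division by zero yields \<open>0\<close>, so the case
    \<open>M_x \<nu> = 0\<close> is split off before clearing denominators.\<close>
  have step: "0 < \<eta> / \<epsilon>" "\<eta> / \<epsilon> * (M_x \<nu>)\<^sup>2 \<le> 2"
    using \<eta> \<epsilon>_pos by (cases "M_x \<nu> = 0"; simp add: field_simps)+
  have norm1: "(LINT z:Z|\<nu>. gibbs f g h (u, z)) = 1" if "u \<in> U" for u
    using gibbs_integral_snd_pos[OF continuous_on_const[of _ 0] g h that] \<epsilon>_pos
    by (subst gibbs_split_f) (simp add: f_def f_update_gibbs exp_minus)
  have le1: "(LINT z:Z|\<nu>. gibbs f g' h (u, z)) \<le> 1" if "u \<in> U" for u
  proof -
    define d where "d = g_direction \<nu> \<epsilon> f g h u"
    \<comment> \<open>Absorbing the prefactor \<open>exp (f u / \<epsilon>)\<close> into the kernel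
      shows \<open>d\<close> as the mean of \<open>x\<close> under a probability density.\<close>
    have d: "d = (LINT z:Z|\<nu>. gibbs f g h (u, z) *\<^sub>R fst z)"
      unfolding d_def g_direction_gibbs
      by (subst (2) gibbs_split_f) (simp flip: scaleR_scaleR)
    have "gibbs f g' h (u, z) = gibbs f g h (u, z) * exp (- (\<eta> / \<epsilon>) * (d \<bullet> fst z))" for z
      using \<epsilon>_pos
      by (simp add: gibbs_def g'_def d_def inner_diff_left flip: exp_add) (simp add: field_simps)
    then show ?thesis
      \<comment> \<open>Here \<open>s = \<eta> / \<epsilon>\<close>, \<open>B = M_x \<nu>\<close>
        and \<open>m = d\<close>.\<close>
      using M2.set_integral_exp_mean_le_one[OF continuous_on_gibbs_snd[OF f g h that] _ norm1[OF that]
          continuous_on_fst[OF continuous_on_id] _ step d] norm_le_M_x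
      by (auto simp: gibbs_def)
  qed
  have cont: "continuous_on U (\<lambda>u. LINT z:Z|\<nu>. gibbs f g' h (u, z))"
    using M2.continuous_on_set_integral[of U "\<lambda>u z. gibbs f g' h (u, z)"] compact_U
      continuous_on_gibbs[OF f g' h] by (simp add: split_beta')
  have "(LINT w:U \<times> Z|\<mu> \<Otimes>\<^sub>M \<nu>. gibbs f g' h w) = (LINT u:U|\<mu>. LINT z:Z|\<nu>. gibbs f g' h (u, z))"
    by (rule set_integral_pair_fst[OF continuous_on_gibbs[OF f g' h]])
  also have "\<dots> \<le> (LINT u:U|\<mu>. 1)"
    by (intro set_integral_mono M1.set_integrable_continuous cont le1) auto
  also have "\<dots> = (LINT u:U|\<mu>. LINT z:Z|\<nu>. gibbs f g h (u, z))"
    by (rule set_lebesgue_integral_cong) (auto simp: norm1)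
  also have "\<dots> = (LINT w:U \<times> Z|\<mu> \<Otimes>\<^sub>M \<nu>. gibbs f g h w)"
    by (rule set_integral_pair_fst[OF continuous_on_gibbs[OF f g h], symmetric])
  finally show ?thesis
    using \<epsilon>_pos by (simp add: dual_obj_gibbs)
qed

section \<open>Invariances of the objective\<close>

text \<open>The iterates are prescribed only on the supports; this lets them be replaced by the
  closed update formulas inside the objective.\<close>

lemma dual_obj_cong:
  assumes "\<And>u. u \<in> U \<Longrightarrow> f u = f' u" "\<And>u. u \<in> U \<Longrightarrow> g u = g' u" "\<And>z. z \<in> Z \<Longrightarrow> h z = h' z"
  shows "dual_obj \<mu> \<nu> \<epsilon> f g h = dual_obj \<mu> \<nu> \<epsilon> f' g' h'"
proof -
  have "(LINT u:U|\<mu>. f u) = (LINT u:U|\<mu>. f' u)" "(LINT z:Z|\<nu>. h z) = (LINT z:Z|\<nu>. h' z)"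
    using assms by (auto intro!: set_lebesgue_integral_cong)
  moreover have "(LINT w:U \<times> Z|\<mu> \<Otimes>\<^sub>M \<nu>. gibbs f g h w) = (LINT w:U \<times> Z|\<mu> \<Otimes>\<^sub>M \<nu>. gibbs f' g' h' w)"
    using assms by (intro set_lebesgue_integral_cong pair.K_sets) (auto simp: gibbs_def)
  ultimately show ?thesis
    by (simp add: dual_obj_gibbs)
qed

text \<open>The shifts cancel in the exponent. In the linear terms \<open>- a\<close> and
  \<open>+ a\<close> cancel, and \<open>b \<bullet> x\<close> integrates to
  \<open>b \<bullet> E X = 0\<close>.\<close>

lemma dual_obj_shift:
  assumes f: "continuous_on U f" and h: "continuous_on Z h" and EX: "(LINT (x, y)|\<nu>. x) = 0"
  shows "dual_obj \<mu> \<nu> \<epsilon> (\<lambda>u. f u - a) (\<lambda>u. g u - b) (\<lambda>z. h z + a + b \<bullet> fst z) = dual_obj \<mu> \<nu> \<epsilon> f g h"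
proof -
  have cont: "continuous_on Z (\<lambda>z. b \<bullet> fst z)"
    by (intro continuous_intros)
  have "(LINT z:Z|\<nu>. b \<bullet> fst z) = b \<bullet> (LINT z:Z|\<nu>. fst z)"
    using M2.set_integrable_continuous[of fst] continuous_on_fst[OF continuous_on_id, of Z]
    unfolding set_lebesgue_integral_def set_integrable_def
    by (subst integral_inner_right[symmetric]) auto
  also have "(LINT z:Z|\<nu>. fst z) = 0"
    using EX by (subst M2.set_integral_eq_integral)
      (auto simp: split_beta' measurable_cong_sets[OF sets_\<nu> refl]
        intro!: borel_measurable_continuous_onI continuous_intros)
  finally have "(LINT z:Z|\<nu>. h z + a + b \<bullet> fst z) = (LINT z:Z|\<nu>. h z) + a"
    using h cont by (simp add: M2.set_integrable_continuous continuous_on_add)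
  moreover have "(LINT u:U|\<mu>. f u - a) = (LINT u:U|\<mu>. f u) - a"
    using f by (simp add: set_integral_diff(2) M1.set_integrable_continuous)
  moreover have "gibbs (\<lambda>u. f u - a) (\<lambda>u. g u - b) (\<lambda>z. h z + a + b \<bullet> fst z) = gibbs f g h"
    by (auto simp: gibbs_def fun_eq_iff inner_diff_left)
  ultimately show ?thesis
    by (simp add: dual_obj_gibbs)
qed

end

theorem lemma7p1:
  fixes \<mu> :: "(real^'n) measure"
    and \<nu> :: "((real^'m) \<times> (real^'n)) measure"
    and \<epsilon> \<eta> :: real
    and f ft :: "nat \<Rightarrow> real^'n \<Rightarrow> real"
    and g gt :: "nat \<Rightarrow> real^'n \<Rightarrow> real^'m"
    and h ht :: "nat \<Rightarrow> (real^'m) \<times> (real^'n) \<Rightarrow> real"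
  assumes "prob_space \<mu>" and "sets \<mu> = sets borel"
    and "prob_space \<nu>" and "sets \<nu> = sets borel"
    and "compact (msupport \<mu>)" and "compact (X_supp \<nu>)" and "compact (Y_supp \<nu>)"
    and "(LINT (x, y)|\<nu>. x) = 0"
    and "invertible (Sigma_X \<nu>)"
    and "\<epsilon> > 0"
    and "0 < \<eta>" and "\<eta> \<le> 2 * \<epsilon> / (M_x \<nu>)\<^sup>2"
    and "f 0 \<in> C_diamond \<mu>" and "g 0 \<in> C_diamond \<mu>"
    and "continuous_on (X_supp \<nu> \<times> Y_supp \<nu>) (h 0)"
    and "modified_sinkhorn \<mu> \<nu> \<epsilon> \<eta> f g h ft gt ht"
  shows "\<forall>t. dual_obj \<mu> \<nu> \<epsilon> (f t) (g t) (h t) \<le> dual_obj \<mu> \<nu> \<epsilon> (f t) (g t) (ht (Suc t))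
    \<and> dual_obj \<mu> \<nu> \<epsilon> (f t) (g t) (ht (Suc t)) \<le> dual_obj \<mu> \<nu> \<epsilon> (ft (Suc t)) (g t) (ht (Suc t))
    \<and> dual_obj \<mu> \<nu> \<epsilon> (ft (Suc t)) (g t) (ht (Suc t))
        \<le> dual_obj \<mu> \<nu> \<epsilon> (ft (Suc t)) (gt (Suc t)) (ht (Suc t))
    \<and> dual_obj \<mu> \<nu> \<epsilon> (ft (Suc t)) (gt (Suc t)) (ht (Suc t))
        = dual_obj \<mu> \<nu> \<epsilon> (f (Suc t)) (g (Suc t)) (h (Suc t))"
proof -
  interpret sinkhorn_setting \<mu> \<nu> \<epsilon>
    by (intro sinkhorn_setting.intro assms)
  define A B where "A t = (LINT v:U|\<mu>. ft (Suc t) v)" and "B t = (LINT v:U|\<mu>. gt (Suc t) v)" for t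
  note alg = assms(16)[unfolded modified_sinkhorn_def, rule_format]
  have ht: "ht (Suc t) z = h_update \<mu> \<epsilon> (f t) (g t) z" if "z \<in> Z" for t z
    using alg[of t] that by blast
  have ft: "ft (Suc t) u = f_update \<nu> \<epsilon> (g t) (ht (Suc t)) u" if "u \<in> U" for t u
    using alg[of t] that by blast
  \<comment> \<open>The direction at \<open>u\<close> sees its first potential only through the
    value at \<open>u\<close>, so agreement on \<open>U\<close> suffices to insert
    \<open>f_update\<close>, as \<open>dual_obj_le_g_step\<close> expects.\<close>
  have gt: "gt (Suc t) u = g t u - \<eta> *\<^sub>R
      g_direction \<nu> \<epsilon> (f_update \<nu> \<epsilon> (g t) (ht (Suc t))) (g t) (ht (Suc t)) u"
    if "u \<in> U" for t u
  proof -
    have "g_direction \<nu> \<epsilon> (ft (Suc t)) (g t) (ht (Suc t)) u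
        =
      g_direction \<nu> \<epsilon> (f_update \<nu> \<epsilon> (g t) (ht (Suc t))) (g t) (ht (Suc t)) u"
      by (simp add: g_direction_gibbs ft[OF that])
    with alg[of t] that show ?thesis
      by metis
  qed
  have f: "f (Suc t) u = ft (Suc t) u - A t" and g: "g (Suc t) u = gt (Suc t) u - B t"
    if "u \<in> U" for t u
    using alg[of t] that by (auto simp: A_def B_def)
  have h: "h (Suc t) z = ht (Suc t) z + A t + B t \<bullet> fst z" if "z \<in> Z" for t z
    using alg[of t] that by (auto simp: A_def B_def)
  have cont_tilde: "continuous_on Z (ht (Suc t))" "continuous_on U (ft (Suc t))"
      "continuous_on U (gt (Suc t))"
    if "continuous_on U (f t)" "continuous_on U (g t)" for t
  proof -
    show hc: "continuous_on Z (ht (Suc t))"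
      using continuous_on_h_update[OF that] by (simp add: ht cong: continuous_on_cong)
    note fc = continuous_on_f_update[OF that(2) hc]
    then show "continuous_on U (ft (Suc t))"
      by (simp add: ft cong: continuous_on_cong)
    have "continuous_on U (\<lambda>u. g t u - \<eta> *\<^sub>R g_direction \<nu> \<epsilon> (f_update \<nu> \<epsilon> (g t) (ht (Suc t))) (g t) (ht (Suc t)) u)"
      by (intro continuous_intros continuous_on_g_direction that fc hc)
    then show "continuous_on U (gt (Suc t))"
      by (simp add: gt cong: continuous_on_cong)
  qed
  \<comment> \<open>Each ascent lemma asks for continuous potentials; recentring by constants and a
    linear function of \<open>x\<close> preserves this.\<close>
  have cont: "continuous_on U (f t) \<and> continuous_on U (g t) \<and> continuous_on Z (h t)" for t
  proof (induction t)
    case 0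
    then show ?case
      using assms(13-15) by (simp add: C_diamond_def)
  next
    case (Suc t)
    note c = cont_tilde[of t]
    have "continuous_on U (\<lambda>u. ft (Suc t) u - A t)" "continuous_on U (\<lambda>u. gt (Suc t) u - B t)"
      "continuous_on Z (\<lambda>z. ht (Suc t) z + A t + B t \<bullet> fst z)"
      using Suc c by (auto intro!: continuous_intros)
    then show ?case
      by (simp add: f g h cong: continuous_on_cong)
  qed
  show ?thesis
  proof (intro allI conjI)
    fix t
    note c = cont[of t] cont_tilde[of t]
    show "dual_obj \<mu> \<nu> \<epsilon> (f t) (g t) (h t) \<le> dual_obj \<mu> \<nu> \<epsilon> (f t) (g t) (ht (Suc t))"
      using dual_obj_le_h_update[of "f t" "g t" "h t"] c
      by (simp add: ht cong: dual_obj_cong)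
    show "dual_obj \<mu> \<nu> \<epsilon> (f t) (g t) (ht (Suc t)) \<le> dual_obj \<mu> \<nu> \<epsilon> (ft (Suc t)) (g t) (ht (Suc t))"
      using dual_obj_le_f_update[of "f t" "g t" "ht (Suc t)"] c
      by (simp add: ft cong: dual_obj_cong)
    show "dual_obj \<mu> \<nu> \<epsilon> (ft (Suc t)) (g t) (ht (Suc t))
        \<le> dual_obj \<mu> \<nu> \<epsilon> (ft (Suc t)) (gt (Suc t)) (ht (Suc t))"
      using dual_obj_le_g_step[of "g t" "ht (Suc t)" \<eta>] c assms(11,12)
      by (simp add: ft gt cong: dual_obj_cong)
    show "dual_obj \<mu> \<nu> \<epsilon> (ft (Suc t)) (gt (Suc t)) (ht (Suc t))
        = dual_obj \<mu> \<nu> \<epsilon> (f (Suc t)) (g (Suc t)) (h (Suc t))"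
      using dual_obj_shift[of "ft (Suc t)" "ht (Suc t)" "A t" "gt (Suc t)" "B t"] c assms(8)
      by (simp add: f g h cong: dual_obj_cong)
  qed
qed

end
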